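(* The function $A\mapsto r(A)$ is upper semi-continuous on the metric space $(\mathbb{R}_+^{\infty\times\infty},d)$.
   Context: $\mathbb{R}_+^{\infty\times\infty}$ is the set of infinite matrices $A=(a_{ij})_{i,j\in\mathbb{N}}$ with non-negative real entries and $\|A\|:=\sup\{a_{ij}:i,j\in\mathbb{N}\}<\infty$, with the metric $d(A,B)=\|A-B\|=\sup\{|a_{ij}-b_{ij}|:i,j\in\mathbb{N}\}$. The max-algebra product is $(A\otimes B)_{ij}=\sup_{k\in\mathbb{N}}a_{ik}b_{kj}$, and $A^k_\otimes$ is the $k$-th power of $A$ for $\otimes$. The max-algebra spectral radius is $r(A)=\lim_{k\to\infty}\|A^k_\otimes\|^{1/k}=\inf_k\|A^k_\otimes\|^{1/k}$ (the limit exists). *)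

theory Defs
  imports "HOL-Analysis.Analysis"
begin

type_synonym inf_matrix = "nat \<Rightarrow> nat \<Rightarrow> real"

definition bounded_nonneg_matrices :: "inf_matrix set" where
  "bounded_nonneg_matrices =
     {A. (\<forall>i j. 0 \<le> A i j) \<and> bdd_above {A i j | i j. True}}"

definition mat_norm :: "inf_matrix \<Rightarrow> real" where
  "mat_norm A = Sup {A i j | i j. True}"

text \<open>The locale \<^locale>\<open>Metric_space\<close> demands a nonnegative distance on the whole type, hence the
  dummy value outside the carrier. Inside it, every set below whose supremum is
  taken is bounded, so the real suprema are the intended ones.\<close>

definition mat_dist :: "inf_matrix \<Rightarrow> inf_matrix \<Rightarrow> real" where
  "mat_dist A B =
     (if A \<in> bounded_nonneg_matrices \<and> B \<in> bounded_nonneg_matrices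
      then Sup {\<bar>A i j - B i j\<bar> | i j. True} else 0)"

definition max_mult :: "inf_matrix \<Rightarrow> inf_matrix \<Rightarrow> inf_matrix"  (infixl "\<otimes>\<^sub>m" 70) where
  "A \<otimes>\<^sub>m B = (\<lambda>i j. SUP k. A i k * B k j)"

definition max_one :: inf_matrix where
  "max_one = (\<lambda>i j. if i = j then 1 else 0)"

primrec max_power :: "inf_matrix \<Rightarrow> nat \<Rightarrow> inf_matrix" where
  "max_power A 0 = max_one"
| "max_power A (Suc k) = max_power A k \<otimes>\<^sub>m A"

text \<open>The term at \<open>k = 0\<close>, where \<^const>\<open>root\<close> takes the value \<open>0\<close>, does not affect the limit.\<close>

definition max_spectral_radius :: "inf_matrix \<Rightarrow> real" where
  "max_spectral_radius A = lim (\<lambda>k. root k (mat_norm (max_power A k)))"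

definition upper_semicontinuous_map :: "'a topology \<Rightarrow> ('a \<Rightarrow> real) \<Rightarrow> bool" where
  "upper_semicontinuous_map X f \<longleftrightarrow>
     (\<forall>x\<in>topspace X. \<forall>c>f x. eventually (\<lambda>y. f y < c) (nhdsin X x))"

lemma bdd_above_abs_diff:
  assumes "A \<in> bounded_nonneg_matrices" "B \<in> bounded_nonneg_matrices"
  shows "bdd_above {\<bar>A i j - B i j\<bar> | i j. True}"
proof -
  obtain a b where ab: "\<And>i j. A i j \<le> a" "\<And>i j. B i j \<le> b"
    using assms unfolding bounded_nonneg_matrices_def bdd_above_def by blast
  have nn: "0 \<le> A i j" "0 \<le> B i j" for i j
    using assms unfolding bounded_nonneg_matrices_def by auto
  have "\<bar>A i j - B i j\<bar> \<le> a + b" for i j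
    using ab[of i j] nn[of i j] by linarith
  then show ?thesis
    unfolding bdd_above_def by blast
qed

lemma abs_diff_le_mat_dist:
  assumes "A \<in> bounded_nonneg_matrices" "B \<in> bounded_nonneg_matrices"
  shows "\<bar>A i j - B i j\<bar> \<le> mat_dist A B"
proof -
  have "\<bar>A i j - B i j\<bar> \<le> Sup {\<bar>A i j - B i j\<bar> | i j. True}"
    by (rule cSup_upper) (use bdd_above_abs_diff[OF assms] in auto)
  then show ?thesis
    using assms by (simp add: mat_dist_def)
qed

lemma mat_dist_le:
  assumes "A \<in> bounded_nonneg_matrices" "B \<in> bounded_nonneg_matrices"
    and "\<And>i j. \<bar>A i j - B i j\<bar> \<le> c"
  shows "mat_dist A B \<le> c"
proof -
  have "Sup {\<bar>A i j - B i j\<bar> | i j. True} \<le> c"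
    by (rule cSup_least) (use assms(3) in auto)
  then show ?thesis
    using assms by (simp add: mat_dist_def)
qed

lemma Metric_space_bounded_nonneg_matrices:
  "Metric_space bounded_nonneg_matrices mat_dist"
proof
  fix A B :: inf_matrix
  show "0 \<le> mat_dist A B"
  proof (cases "A \<in> bounded_nonneg_matrices \<and> B \<in> bounded_nonneg_matrices")
    case True
    then show ?thesis
      using abs_diff_le_mat_dist[of A B 0 0] by linarith
  qed (auto simp: mat_dist_def)
  show "mat_dist A B = mat_dist B A"
    by (simp add: mat_dist_def abs_minus_commute conj_commute)
next
  fix A B :: inf_matrix
  assume AB: "A \<in> bounded_nonneg_matrices" "B \<in> bounded_nonneg_matrices"
  show "mat_dist A B = 0 \<longleftrightarrow> A = B"
  proof
    assume "mat_dist A B = 0"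
    then have "A i j = B i j" for i j
      using abs_diff_le_mat_dist[OF AB, of i j] by simp
    then show "A = B" by blast
  next
    assume "A = B"
    then show "mat_dist A B = 0"
      by (simp add: mat_dist_def)
  qed
next
  fix A B C :: inf_matrix
  assume M: "A \<in> bounded_nonneg_matrices" "B \<in> bounded_nonneg_matrices"
    "C \<in> bounded_nonneg_matrices"
  show "mat_dist A C \<le> mat_dist A B + mat_dist B C"
  proof (rule mat_dist_le[OF M(1,3)])
    fix i j
    show "\<bar>A i j - C i j\<bar> \<le> mat_dist A B + mat_dist B C"
      using abs_diff_le_mat_dist[OF M(1,2), of i j] abs_diff_le_mat_dist[OF M(2,3), of i j]
      by linarith
  qed
qed

end

(* Submultiplicativity of the norms of the max-algebra powers exhibits r(A) as an infimum over
   m \<ge> 1 of the functions A \<mapsto> root m (norm of the m-th power of A) (Fekete). Each of these is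
   continuous, since the m-th power is Lipschitz on norm-bounded sets, and an infimum of continuous
   functions is upper semi-continuous. *)
theory Submission
  imports Defs
begin

section \<open>Fekete's lemma for submultiplicative sequences\<close>

text \<open>Stripping off \<open>m\<close> at a time reduces \<open>n\<close> to a remainder below
  \<open>m\<close>, so \<open>a n \<le> C * x ^ n\<close> for some \<open>x < c\<close>, with
  \<open>C\<close> absorbing the finitely many remainders. Finally \<open>root n C\<close> tends to
  1.\<close>

lemma submultiplicative_eventually_root_less:
  fixes a :: "nat \<Rightarrow> real"
  assumes nonneg: "\<And>n. 0 \<le> a n" and submult: "\<And>m n. a (m + n) \<le> a m * a n"
    and m: "0 < m" and less: "root m (a m) < c"
  shows "eventually (\<lambda>n. root n (a n) < c) sequentially"
proof -
  \<comment> \<open>The midpoint leaves room below \<open>c\<close> for the factor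
    \<open>root n C\<close>, and it is positive even if \<open>a m = 0\<close>, so division by
    \<open>x ^ r\<close> is legitimate.\<close>
  define x where "x = (root m (a m) + c) / 2"
  have root0: "0 \<le> root m (a m)"
    by (intro real_root_ge_zero nonneg)
  have x: "0 < x" "root m (a m) \<le> x" "x < c"
    using root0 less by (auto simp: x_def)
  have am: "a m \<le> x ^ m"
    using power_mono[OF x(2) root0, of m] m nonneg[of m] by simp
  define M where "M = Max ((\<lambda>r. a r / x ^ r) ` {..<m})"
  \<comment> \<open>The remainder \<open>r = 0\<close> gives \<open>0 \<le> M\<close>; adding 1
    makes \<open>C\<close> strictly positive, as \<open>root n C\<close> tending to 1
    requires.\<close>
  define C where "C = M + 1"
  have M_ge: "a r / x ^ r \<le> M" if "r < m" for r
    unfolding M_def by (rule Max_ge) (use that in auto)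
  have C: "0 < C"
    using M_ge[of 0] m nonneg[of 0] by (simp add: C_def)
  have bound: "a n \<le> C * x ^ n" for n
  proof (induction n rule: less_induct)
    case (less n)
    show ?case
    proof (cases "n < m")
      case True
      then have "a n / x ^ n \<le> C"
        using M_ge[of n] by (simp add: C_def)
      then show ?thesis
        using x(1) by (simp add: pos_divide_le_eq)
    next
      case False
      then have "a n \<le> a m * a (n - m)"
        using submult[of m "n - m"] by simp
      also have "\<dots> \<le> x ^ m * (C * x ^ (n - m))"
        by (intro mult_mono am less) (use False m x(1) nonneg in auto)
      also have "\<dots> = C * x ^ n"
        using False by (simp flip: power_add)
      finally show ?thesis .
    qed
  qed
  have "(\<lambda>n. root n C * x) \<longlonglongrightarrow> 1 * x"
    by (intro tendsto_intros LIMSEQ_root_const C)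
  then have "eventually (\<lambda>n. root n C * x < c) sequentially"
    using x(3) by (intro order_tendstoD(2)) auto
  then show ?thesis
    using eventually_gt_at_top[of 0]
  proof eventually_elim
    case (elim n)
    have "root n (a n) \<le> root n (C * x ^ n)"
      using elim bound by simp
    also have "\<dots> = root n C * x"
      using elim x(1) by (simp add: real_root_mult real_root_power_cancel)
    finally show ?case
      using elim by simp
  qed
qed

text \<open>Index 0 is excluded because \<open>root 0\<close> is constantly 0 and would force the
  infimum to be 0.\<close>

lemma submultiplicative_root_tendsto_INF:
  fixes a :: "nat \<Rightarrow> real"
  assumes nonneg: "\<And>n. 0 \<le> a n" and submult: "\<And>m n. a (m + n) \<le> a m * a n"
  shows "(\<lambda>n. root n (a n)) \<longlonglongrightarrow> (INF n\<in>{0<..}. root n (a n))"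
proof (rule order_tendstoI)
  have bdd: "bdd_below ((\<lambda>n. root n (a n)) ` {0<..})"
    using nonneg by (intro bdd_belowI2[of _ 0]) simp
  fix c
  show "eventually (\<lambda>n. c < root n (a n)) sequentially" if "c < (INF n\<in>{0<..}. root n (a n))"
    using eventually_gt_at_top[of 0]
  proof eventually_elim
    case (elim n)
    show ?case
      using that cINF_lower[OF bdd, of n] elim by simp
  qed
  show "eventually (\<lambda>n. root n (a n) < c) sequentially" if "(INF n\<in>{0<..}. root n (a n)) < c"
  proof -
    have "\<exists>m\<in>{0<..}. root m (a m) < c"
      using that bdd by (subst (asm) cINF_less_iff) auto
    then show ?thesis
      using submultiplicative_eventually_root_less[OF nonneg submult] by blast
  qed
qed

section \<open>Entrywise bounds for the norm and the product\<close>

lemma bounded_nonneg_matricesI: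
  assumes "\<And>i j. 0 \<le> A i j" "\<And>i j. A i j \<le> c"
  shows "A \<in> bounded_nonneg_matrices"
  using assms by (auto simp: bounded_nonneg_matrices_def intro!: bdd_aboveI)

lemma entry_nonneg: "A \<in> bounded_nonneg_matrices \<Longrightarrow> 0 \<le> A i j"
  by (simp add: bounded_nonneg_matrices_def)

lemma entry_le_mat_norm: "A \<in> bounded_nonneg_matrices \<Longrightarrow> A i j \<le> mat_norm A"
  unfolding bounded_nonneg_matrices_def mat_norm_def by (intro cSup_upper) auto

lemma mat_norm_le: "(\<And>i j. A i j \<le> c) \<Longrightarrow> mat_norm A \<le> c"
  unfolding mat_norm_def by (rule cSup_least) auto

lemma mat_norm_nonneg: "A \<in> bounded_nonneg_matrices \<Longrightarrow> 0 \<le> mat_norm A"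
  using entry_nonneg[of A 0 0] entry_le_mat_norm[of A 0 0] by linarith

lemma max_mult_le: "(\<And>k. A i k * B k j \<le> c) \<Longrightarrow> (A \<otimes>\<^sub>m B) i j \<le> c"
  unfolding max_mult_def by (rule cSUP_least) auto

text \<open>The product of the norms bounds all terms, so the real supremum in the product is a
  genuine one.\<close>

lemma le_max_mult:
  assumes "A \<in> bounded_nonneg_matrices" "B \<in> bounded_nonneg_matrices"
  shows "A i k * B k j \<le> (A \<otimes>\<^sub>m B) i j"
  unfolding max_mult_def
proof (rule cSUP_upper)
  show "bdd_above (range (\<lambda>k. A i k * B k j))"
    by (rule bdd_aboveI2[of _ _ "mat_norm A * mat_norm B"])
      (intro mult_mono entry_le_mat_norm mat_norm_nonneg entry_nonneg assms)
qed simp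

lemma max_mult_in_bounded_nonneg_matrices:
  assumes "A \<in> bounded_nonneg_matrices" "B \<in> bounded_nonneg_matrices"
  shows "A \<otimes>\<^sub>m B \<in> bounded_nonneg_matrices"
proof (rule bounded_nonneg_matricesI)
  fix i j
  have "0 \<le> A i 0 * B 0 j"
    using assms by (simp add: entry_nonneg)
  then show "0 \<le> (A \<otimes>\<^sub>m B) i j"
    using le_max_mult[OF assms, of i 0 j] by linarith
  show "(A \<otimes>\<^sub>m B) i j \<le> mat_norm A * mat_norm B"
    by (intro max_mult_le mult_mono entry_le_mat_norm mat_norm_nonneg entry_nonneg assms)
qed

section \<open>Norms of powers, and the spectral radius as an infimum\<close>

lemma max_power_in_bounded_nonneg_matrices:
  assumes "A \<in> bounded_nonneg_matrices"
  shows "max_power A m \<in> bounded_nonneg_matrices"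
proof (induction m)
  case 0
  show ?case
    by (auto simp: max_one_def intro: bounded_nonneg_matricesI[of _ 1])
qed (simp add: max_mult_in_bounded_nonneg_matrices assms)

text \<open>Bounding a single column \<open>j\<close> by an arbitrary \<open>c\<close> makes
  induction on \<open>n\<close> work without associativity of the product: if \<open>c\<close>
  bounds column \<open>j\<close> of power \<open>n + 1\<close>, then \<open>c / A l j\<close> bounds
  column \<open>l\<close> of power \<open>n\<close>.\<close>

lemma max_power_add_le:
  assumes A: "A \<in> bounded_nonneg_matrices" and "\<And>k. max_power A n k j \<le> c"
  shows "max_power A (m + n) i j \<le> mat_norm (max_power A m) * c"
  using assms(2)
proof (induction n arbitrary: j c)
  case 0
  \<comment> \<open>The diagonal entry of the identity in column \<open>j\<close> is 1.\<close>
  have "1 \<le> c"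
    using 0[of j] by (simp add: max_one_def)
  then have "mat_norm (max_power A m) * 1 \<le> mat_norm (max_power A m) * c"
    by (intro mult_left_mono mat_norm_nonneg max_power_in_bounded_nonneg_matrices A)
  then show ?case
    using entry_le_mat_norm[OF max_power_in_bounded_nonneg_matrices[OF A], of m i j] by simp
next
  case (Suc n)
  let ?M = "mat_norm (max_power A m)"
  note pow = max_power_in_bounded_nonneg_matrices[OF A]
  have entry: "max_power A n k l * A l j \<le> c" for k l
    using le_max_mult[OF pow A, of n k l j] Suc.prems[of k] by simp
  have c0: "0 \<le> c"
    using entry_nonneg[OF pow, of "Suc n" 0 j] Suc.prems[of 0] by linarith
  have "max_power A (m + n) i l * A l j \<le> ?M * c" for l
  \<comment> \<open>A zero entry gives a zero term; otherwise the induction hypothesis applies to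
    column \<open>l\<close> with the bound \<open>c / A l j\<close>.\<close>
  proof (cases "A l j = 0")
    case True
    then show ?thesis
      using c0 mat_norm_nonneg[OF pow] by simp
  next
    case False
    then have pos: "0 < A l j"
      using entry_nonneg[OF A, of l j] by simp
    then have "max_power A (m + n) i l \<le> ?M * (c / A l j)"
      using entry by (intro Suc.IH) (simp add: pos_le_divide_eq)
    then show ?thesis
      using pos by (simp add: pos_le_divide_eq)
  qed
  then show ?case
    by (simp add: max_mult_le)
qed

lemma mat_norm_max_power_add_le:
  assumes "A \<in> bounded_nonneg_matrices"
  shows "mat_norm (max_power A (m + n)) \<le> mat_norm (max_power A m) * mat_norm (max_power A n)"
  by (intro mat_norm_le max_power_add_le entry_le_mat_norm
      max_power_in_bounded_nonneg_matrices assms)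

lemma max_spectral_radius_eq_INF:
  assumes "A \<in> bounded_nonneg_matrices"
  shows "max_spectral_radius A = (INF n\<in>{0<..}. root n (mat_norm (max_power A n)))"
  unfolding max_spectral_radius_def
  by (intro limI submultiplicative_root_tendsto_INF mat_norm_max_power_add_le
      mat_norm_nonneg max_power_in_bounded_nonneg_matrices assms)

lemma bdd_below_root_mat_norm:
  assumes "A \<in> bounded_nonneg_matrices"
  shows "bdd_below ((\<lambda>n. root n (mat_norm (max_power A n))) ` S)"
  by (intro bdd_belowI2[of _ 0] real_root_ge_zero mat_norm_nonneg
      max_power_in_bounded_nonneg_matrices assms)

section \<open>Perturbation of a fixed power\<close>

text \<open>Exchanging the \<open>m\<close> factors one by one costs at most
  \<open>K ^ (m - 1) * d\<close> each; as \<open>1 \<le> K\<close>, the exponent may be rounded up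
  to \<open>m\<close>. The one-sided estimate is what upper semicontinuity calls for.\<close>

lemma max_power_perturbation:
  assumes A: "A \<in> bounded_nonneg_matrices" and B: "B \<in> bounded_nonneg_matrices"
    and AK: "\<And>i j. A i j \<le> K" and BK: "\<And>i j. B i j \<le> K" and K: "1 \<le> K"
    and d: "0 \<le> d" "\<And>i j. B i j \<le> A i j + d"
  shows "max_power B m i j \<le> max_power A m i j + real m * K ^ m * d"
proof (induction m arbitrary: i j)
  case (Suc m)
  note powA = max_power_in_bounded_nonneg_matrices[OF A]
  have pow_le: "max_power A n i j \<le> K ^ n" for n i j
  proof (induction n arbitrary: i j)
    case (Suc n)
    have "max_power A n i k * A k j \<le> K ^ n * K" for k
      using K Suc AK by (intro mult_mono) (auto simp: entry_nonneg[OF A])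
    then show ?case
      by (simp add: max_mult_le mult.commute)
  qed (simp add: max_one_def)
  have "max_power B m i k * B k j \<le> max_power A (Suc m) i j + real (Suc m) * K ^ Suc m * d" for k
  proof -
    have "max_power B m i k * B k j \<le> (max_power A m i k + real m * K ^ m * d) * B k j"
      by (intro mult_right_mono Suc entry_nonneg B)
    also have "\<dots> = max_power A m i k * B k j + real m * K ^ m * d * B k j"
      by (simp add: algebra_simps)
    \<comment> \<open>The last factor \<open>B k j\<close> is replaced by \<open>A k j + d\<close>
      in the main term, but only by \<open>K\<close> in the error already accumulated.\<close>
    also have "\<dots> \<le> max_power A m i k * (A k j + d) + real m * K ^ m * d * K"
      using K d(1) by (intro add_mono mult_left_mono d(2) BK) (auto simp: entry_nonneg[OF powA])
    also have "\<dots> = max_power A m i k * A k j + max_power A m i k * d + real m * K ^ Suc m * d"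
      by (simp add: algebra_simps)
    also have "\<dots> \<le> max_power A (Suc m) i j + K ^ Suc m * d + real m * K ^ Suc m * d"
    proof (intro add_mono order_refl)
      show "max_power A m i k * A k j \<le> max_power A (Suc m) i j"
        using le_max_mult[OF powA A] by simp
      \<comment> \<open>Raising the exponent by one lets the new error merge with the old, turning
        the coefficient \<open>m\<close> into \<open>m + 1\<close>.\<close>
      have "max_power A m i k \<le> K ^ Suc m"
        using pow_le[of m i k] power_increasing[of m "Suc m" K] K by linarith
      then show "max_power A m i k * d \<le> K ^ Suc m * d"
        using d(1) by (rule mult_right_mono)
    qed
    also have "\<dots> = max_power A (Suc m) i j + real (Suc m) * K ^ Suc m * d"
      by (simp add: algebra_simps)
    finally show ?thesis .
  qed
  then have "(max_power B m \<otimes>\<^sub>m B) i j \<le> max_power A (Suc m) i j + real (Suc m) * K ^ Suc m * d"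
    by (rule max_mult_le)
  then show ?case by simp
qed simp

lemma mat_norm_max_power_upper_semicontinuous:
  assumes A: "A \<in> bounded_nonneg_matrices" and less: "mat_norm (max_power A m) < c"
  obtains d where "0 < d"
    "\<And>B. B \<in> bounded_nonneg_matrices \<Longrightarrow> mat_dist A B < d \<Longrightarrow> mat_norm (max_power B m) < c"
proof
  \<comment> \<open>This bounds the entries of \<open>A\<close> and of every \<open>B\<close> at
    distance less than 1.\<close>
  define K where "K = mat_norm A + 1"
  define e where "e = c - mat_norm (max_power A m)"
  \<comment> \<open>The 1 in the minimum secures the bound \<open>K\<close> for \<open>B\<close>;
    the added 1 keeps the denominator positive at \<open>m = 0\<close>, and the factor 2 makes the
    final estimate strict.\<close>
  define d where "d = min 1 (e / (2 * (real m * K ^ m + 1)))"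
  have K: "1 \<le> K"
    using mat_norm_nonneg[OF A] by (simp add: K_def)
  have e: "0 < e"
    using less by (simp add: e_def)
  have pos: "0 < real m * K ^ m + 1"
    using K by (intro add_nonneg_pos) auto
  show d: "0 < d"
    using e pos by (simp add: d_def)
  have "(real m * K ^ m + 1) * d \<le> (real m * K ^ m + 1) * (e / (2 * (real m * K ^ m + 1)))"
    using pos by (intro mult_left_mono) (auto simp: d_def)
  also have "\<dots> < e"
    using e pos by (simp add: pos_divide_less_eq mult.commute)
  finally have small: "real m * K ^ m * d < e"
    using d by (simp add: algebra_simps)
  fix B
  assume B: "B \<in> bounded_nonneg_matrices" and dist: "mat_dist A B < d"
  have BA: "B i j \<le> A i j + d" for i j
    using abs_diff_le_mat_dist[OF A B, of i j] dist by linarith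
  have AK: "A i j \<le> K" for i j
    using entry_le_mat_norm[OF A, of i j] by (simp add: K_def)
  have BK: "B i j \<le> K" for i j
  proof -
    have "d \<le> 1"
      by (simp add: d_def)
    then show ?thesis
      using BA[of i j] entry_le_mat_norm[OF A, of i j] by (simp add: K_def)
  qed
  have "max_power B m i j \<le> mat_norm (max_power A m) + real m * K ^ m * d" for i j
    using max_power_perturbation[OF A B AK BK K less_imp_le[OF d] BA, of m i j]
      entry_le_mat_norm[OF max_power_in_bounded_nonneg_matrices[OF A], of m i j] by linarith
  then have "mat_norm (max_power B m) \<le> mat_norm (max_power A m) + real m * K ^ m * d"
    by (rule mat_norm_le)
  then show "mat_norm (max_power B m) < c"
    using small by (simp add: e_def)
qed

section \<open>From a single power to the spectral radius\<close>

theorem proposition5p1: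
  shows "upper_semicontinuous_map
           (Metric_space.mtopology bounded_nonneg_matrices mat_dist)
           max_spectral_radius"
proof -
  interpret Metric_space bounded_nonneg_matrices mat_dist
    by (rule Metric_space_bounded_nonneg_matrices)
  show ?thesis
    unfolding upper_semicontinuous_map_def topspace_mtopology
  proof (intro ballI allI impI)
    fix A c
    assume A: "A \<in> bounded_nonneg_matrices" and c: "max_spectral_radius A < c"
    let ?a = "\<lambda>n. mat_norm (max_power A n)"
    \<comment> \<open>An infimum below \<open>c\<close> is witnessed by one exponent
      \<open>m\<close>, which then serves for all nearby matrices.\<close>
    have "\<exists>m\<in>{0<..}. root m (?a m) < c"
      using c bdd_below_root_mat_norm[OF A]
      unfolding max_spectral_radius_eq_INF[OF A] by (subst (asm) cINF_less_iff) auto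
    then obtain m where m: "root m (?a m) < c" "0 < m"
      by auto
    have a0: "0 \<le> ?a m"
      by (intro mat_norm_nonneg max_power_in_bounded_nonneg_matrices A)
    then have c0: "0 < c"
      using m(1) order_le_less_trans[OF real_root_ge_zero] by blast
    \<comment> \<open>Passing to \<open>m\<close>-th powers gives a strict inequality between norms,
      which is stable under small perturbations of \<open>A\<close>.\<close>
    have "root m (?a m) < root m (c ^ m)"
      using m c0 by (simp add: real_root_power_cancel)
    then have "?a m < c ^ m"
      using m(2) by simp
    then obtain d where d: "0 < d"
      "\<And>B. B \<in> bounded_nonneg_matrices \<Longrightarrow> mat_dist A B < d \<Longrightarrow> mat_norm (max_power B m) < c ^ m"
      using mat_norm_max_power_upper_semicontinuous[OF A] by blast
    have "max_spectral_radius B < c" if "B \<in> mball A d" for B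
    proof -
      have B: "B \<in> bounded_nonneg_matrices" "mat_dist A B < d"
        using that by auto
      \<comment> \<open>The infimum formula for \<open>B\<close>, evaluated at the exponent chosen
        for \<open>A\<close>.\<close>
      have "max_spectral_radius B \<le> root m (mat_norm (max_power B m))"
        unfolding max_spectral_radius_eq_INF[OF B(1)]
        using m(2) by (intro cINF_lower bdd_below_root_mat_norm B(1)) simp
      also have "\<dots> < root m (c ^ m)"
        using d(2)[OF B] m(2) by simp
      also have "\<dots> = c"
        using m(2) c0 by (simp add: real_root_power_cancel)
      finally show ?thesis .
    qed
    then show "eventually (\<lambda>B. max_spectral_radius B < c) (nhdsin mtopology A)"
      using A d(1) openin_mball[of A d]
      by (auto simp: eventually_nhdsin intro!: exI[of _ "mball A d"])
  qed
qed

end
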